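(* Let $i\in\{1,\dots,13\}$, $s\in\mathbb R$ and $\lambda\in\mathbb R\setminus\{0\}$. If $u=U(t,x,y,z)$, $v=V(t,x,y,z)$, $w=W(t,x,y,z)$, $p=P(t,x,y,z)$, $q=Q(t,x,y,z)$ is a solution of the three dimensional Euler equations of gas dynamics (system (E) in the context), then so are the functions $(u^{(i)},v^{(i)},w^{(i)},p^{(i)},q^{(i)})$ of $(t,x,y,z)$ defined as follows. (1) $(u^{(1)},v^{(1)},w^{(1)},p^{(1)},q^{(1)})=(U,V,W,P,Q)(t,x+s,y,z)$. (2) $(u^{(2)},v^{(2)},w^{(2)},p^{(2)},q^{(2)})=(U,V,W,P,Q)(t,x,y+s,z)$. (3) $(u^{(3)},v^{(3)},w^{(3)},p^{(3)},q^{(3)})=(U,V,W,P,Q)(t,x,y,z+s)$. (4) $(u^{(4)},v^{(4)},w^{(4)},p^{(4)},q^{(4)})=(U,V,W,P,Q)(t+s,x,y,z)$. (5) $(u^{(5)},v^{(5)},w^{(5)},p^{(5)},q^{(5)})=(U-s,V,W,P,Q)$ with $U,V,W,P,Q$ evaluated at $(t,x+st,y,z)$. (6) $(u^{(6)},v^{(6)},w^{(6)},p^{(6)},q^{(6)})=(U,V-s,W,P,Q)$ with $U,V,W,P,Q$ evaluated at $(t,x,y+st,z)$. (7) $(u^{(7)},v^{(7)},w^{(7)},p^{(7)},q^{(7)})=(U,V,W-s,P,Q)$ with $U,V,W,P,Q$ evaluated at $(t,x,y,z+st)$. (8) $(u^{(8)},v^{(8)},w^{(8)},p^{(8)},q^{(8)})=(\lambda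 U,\lambda V,\lambda W,P,\lambda^{-2}Q)$ with $U,V,W,P,Q$ evaluated at $(\lambda t,x,y,z)$. (9) $(u^{(9)},v^{(9)},w^{(9)},p^{(9)},q^{(9)})=(\lambda^{-1}U,\lambda^{-1}V,\lambda^{-1}W,P,\lambda^{2}Q)$ with $U,V,W,P,Q$ evaluated at $(t,\lambda x,\lambda y,\lambda z)$. (10) $(u^{(10)},v^{(10)},w^{(10)},p^{(10)},q^{(10)})=(\cos s\,U-\sin s\,V,\ \sin s\,U+\cos s\,V,\ W,\ P,\ Q)$ with $U,V,W,P,Q$ evaluated at $(t,\ x\cos s+y\sin s,\ y\cos s-x\sin s,\ z)$. (11) $(u^{(11)},v^{(11)},w^{(11)},p^{(11)},q^{(11)})=(U,\ \cos s\,V+\sin s\,W,\ \cos s\,W-\sin s\,V,\ P,\ Q)$ with $U,V,W,P,Q$ evaluated at $(t,\ x,\ y\cos s-z\sin s,\ z\cos s+y\sin s)$. (12) $(u^{(12)},v^{(12)},w^{(12)},p^{(12)},q^{(12)})=(\cos s\,U+\sin s\,W,\ V,\ \cos s\,W-\sin s\,U,\ P,\ Q)$ with $U,V,W,P,Q$ evaluated at $(t,\ x\cos s-z\sin s,\ y,\ x\sin s+z\cos s)$. (13) $(u^{(13)},v^{(13)},w^{(13)},p^{(13)},q^{(13)})=(U,V,W,\lambda P,\lambda Q)(t,x,y,z)$.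
   Context: The system (E), for unknown functions $u,v,w$ (velocity components), $p$ (pressure), $q$ (density) of the independent variables $(t,x,y,z)$, with $\gamma\in\mathbb R$ the adiabatic index, is $$\begin{aligned} &u_t+uu_x+vu_y+wu_z+\tfrac1q p_x=0,\\ &v_t+uv_x+vv_y+wv_z+\tfrac1q p_y=0,\\ &w_t+uw_x+vw_y+ww_z+\tfrac1q p_z=0,\\ &q_t+q(u_x+v_y+w_z)+uq_x+vq_y+wq_z=0,\\ &p_t+\gamma p(u_x+v_y+w_z)+up_x+vp_y+wp_z=0. \end{aligned}$$ *)

theory Defs
  imports "HOL-Analysis.Analysis"
begin

text \<open>Space-time points are tuples \<open>(t, x, y, z)\<close>; fields are functions of such a tuple.\<close>

type_synonym point = "real \<times> real \<times> real \<times> real"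

fun D_t :: "(point \<Rightarrow> real) \<Rightarrow> point \<Rightarrow> real" where
  "D_t f (t, x, y, z) = deriv (\<lambda>a. f (a, x, y, z)) t"

fun D_x :: "(point \<Rightarrow> real) \<Rightarrow> point \<Rightarrow> real" where
  "D_x f (t, x, y, z) = deriv (\<lambda>a. f (t, a, y, z)) x"

fun D_y :: "(point \<Rightarrow> real) \<Rightarrow> point \<Rightarrow> real" where
  "D_y f (t, x, y, z) = deriv (\<lambda>a. f (t, x, a, z)) y"

fun D_z :: "(point \<Rightarrow> real) \<Rightarrow> point \<Rightarrow> real" where
  "D_z f (t, x, y, z) = deriv (\<lambda>a. f (t, x, y, a)) z"

definition C1_on :: "point set \<Rightarrow> (point \<Rightarrow> real) \<Rightarrow> bool" where
  "C1_on \<Omega> f \<longleftrightarrow>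
     (\<exists>f' :: point \<Rightarrow> point \<Rightarrow>\<^sub>L real.
        (\<forall>a\<in>\<Omega>. (f has_derivative blinfun_apply (f' a)) (at a)) \<and> continuous_on \<Omega> f')"

text \<open>Classical solutions on an open set. The density is only required to be nonzero, so that
  \<open>1 / q\<close> makes sense; requiring \<open>q > 0\<close> would not be invariant under \<open>q \<mapsto> \<lambda> q\<close> with \<open>\<lambda> < 0\<close>.\<close>

definition euler_solution ::
  "real \<Rightarrow> point set \<Rightarrow> (point \<Rightarrow> real) \<Rightarrow> (point \<Rightarrow> real) \<Rightarrow> (point \<Rightarrow> real) \<Rightarrow>
   (point \<Rightarrow> real) \<Rightarrow> (point \<Rightarrow> real) \<Rightarrow> bool" where
  "euler_solution \<gamma> \<Omega> u v w p q \<longleftrightarrow>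
     open \<Omega> \<and>
     C1_on \<Omega> u \<and> C1_on \<Omega> v \<and> C1_on \<Omega> w \<and> C1_on \<Omega> p \<and> C1_on \<Omega> q \<and>
     (\<forall>a\<in>\<Omega>. q a \<noteq> 0 \<and>
        D_t u a + u a * D_x u a + v a * D_y u a + w a * D_z u a + 1 / q a * D_x p a = 0 \<and>
        D_t v a + u a * D_x v a + v a * D_y v a + w a * D_z v a + 1 / q a * D_y p a = 0 \<and>
        D_t w a + u a * D_x w a + v a * D_y w a + w a * D_z w a + 1 / q a * D_z p a = 0 \<and>
        D_t q a + q a * (D_x u a + D_y v a + D_z w a)
          + u a * D_x q a + v a * D_y q a + w a * D_z q a = 0 \<and>
        D_t p a + \<gamma> * p a * (D_x u a + D_y v a + D_z w a)
          + u a * D_x p a + v a * D_y p a + w a * D_z p a = 0)"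

end

theory Submission
  imports Defs
begin

text \<open>
  Every one of the thirteen transformations is an instance of a single one. Let
  \<open>\<phi> (t, X) = (\<tau> t + t\<^sub>0, A X + t b + c)\<close> and suppose \<open>\<sigma> A A\<^sup>T = 1\<close>. The velocity
  \<open>u' = \<sigma> A\<^sup>T (\<tau> U \<circ> \<phi> - b)\<close> is the one for which \<open>A u' = \<tau> U \<circ> \<phi> - b\<close>, so that the material
  derivative of \<open>f \<circ> \<phi>\<close> along \<open>u'\<close> is \<open>\<tau>\<close> times that of \<open>f\<close> along \<open>U\<close>. Likewise
  \<open>div u' = \<sigma> \<tau> tr (A\<^sup>T DU A) = \<tau> div U\<close>. Each equation of the system for the transformed fields is
  then a linear combination of the original ones, provided the factors \<open>\<kappa>\<close> of the pressure and
  \<open>\<rho>\<close> of the density satisfy \<open>\<kappa> = \<sigma> \<tau>\<^sup>2 \<rho>\<close>.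
\<close>

section \<open>Partial derivatives read off from the total derivative\<close>

text \<open>The chain rule is available for total derivatives, whereas the system is written with
  derivatives along coordinate lines. This predicate bridges the two by recording a total derivative
  through its four coefficients.\<close>

definition has_partials :: "(point \<Rightarrow> real) \<Rightarrow> real \<Rightarrow> real \<Rightarrow> real \<Rightarrow> real \<Rightarrow> point \<Rightarrow> bool" where
  "has_partials f ft fx fy fz a \<longleftrightarrow>
     (f has_derivative (\<lambda>(dt, dx, dy, dz). ft * dt + fx * dx + fy * dy + fz * dz)) (at a)"

text \<open>Composing \<open>f\<close> with the affine embedding of a coordinate line through
  \<open>a\<close> leaves exactly one coefficient of the total derivative.\<close>

lemma has_partials_imp_D:
  assumes "has_partials f ft fx fy fz a"
  shows "D_t f a = ft" "D_x f a = fx" "D_y f a = fy" "D_z f a = fz"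
proof -
  obtain t x y z where a: "a = (t, x, y, z)"
    by (metis prod.exhaust)
  note f = assms[unfolded has_partials_def a]
  have "((\<lambda>r. (r, x, y, z)) has_derivative (\<lambda>h. (h, 0, 0, 0))) (at t)"
    by (auto intro!: derivative_eq_intros simp: zero_prod_def)
  from has_derivative_compose[OF this f] show "D_t f a = ft"
    unfolding a by (auto intro!: DERIV_imp_deriv simp: has_field_derivative_def)
  have "((\<lambda>r. (t, r, y, z)) has_derivative (\<lambda>h. (0, h, 0, 0))) (at x)"
    by (auto intro!: derivative_eq_intros simp: zero_prod_def)
  from has_derivative_compose[OF this f] show "D_x f a = fx"
    unfolding a by (auto intro!: DERIV_imp_deriv simp: has_field_derivative_def)
  have "((\<lambda>r. (t, x, r, z)) has_derivative (\<lambda>h. (0, 0, h, 0))) (at y)"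
    by (auto intro!: derivative_eq_intros simp: zero_prod_def)
  from has_derivative_compose[OF this f] show "D_y f a = fy"
    unfolding a by (auto intro!: DERIV_imp_deriv simp: has_field_derivative_def)
  have "((\<lambda>r. (t, x, y, r)) has_derivative (\<lambda>h. (0, 0, 0, h))) (at z)"
    by (auto intro!: derivative_eq_intros simp: zero_prod_def)
  from has_derivative_compose[OF this f] show "D_z f a = fz"
    unfolding a by (auto intro!: DERIV_imp_deriv simp: has_field_derivative_def)
qed

text \<open>A linear functional is determined by its values on the four basis vectors, so the
  derivative supplied by \<open>C1_on\<close> has the coordinate form;
  \<open>has_partials_imp_D\<close> then identifies these values with the partial
  derivatives.\<close>

lemma C1_on_imp_has_partials:
  assumes "C1_on \<Omega> f" "a \<in> \<Omega>"
  shows "has_partials f (D_t f a) (D_x f a) (D_y f a) (D_z f a) a"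
proof -
  from assms obtain L :: "point \<Rightarrow>\<^sub>L real" where L: "(f has_derivative L) (at a)"
    unfolding C1_on_def by blast
  have L_eq: "L (dt, dx, dy, dz) = L (1, 0, 0, 0) * dt + L (0, 1, 0, 0) * dx
      + L (0, 0, 1, 0) * dy + L (0, 0, 0, 1) * dz" for dt dx dy dz
  proof -
    have "(dt, dx, dy, dz) = dt *\<^sub>R (1, 0, 0, 0) + dx *\<^sub>R (0, 1, 0, 0)
        + dy *\<^sub>R (0, 0, 1, 0) + dz *\<^sub>R (0, 0, 0, 1)"
      by simp
    then have "L (dt, dx, dy, dz) = L (dt *\<^sub>R (1, 0, 0, 0) + dx *\<^sub>R (0, 1, 0, 0)
        + dy *\<^sub>R (0, 0, 1, 0) + dz *\<^sub>R (0, 0, 0, 1))"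
      by (rule arg_cong)
    also have "\<dots> = dt *\<^sub>R L (1, 0, 0, 0) + dx *\<^sub>R L (0, 1, 0, 0)
        + dy *\<^sub>R L (0, 0, 1, 0) + dz *\<^sub>R L (0, 0, 0, 1)"
      by (simp only: blinfun.add_right blinfun.scaleR_right)
    finally show ?thesis
      by (simp only: real_scaleR_def mult.commute)
  qed
  have "blinfun_apply L = (\<lambda>(dt, dx, dy, dz). L (1, 0, 0, 0) * dt + L (0, 1, 0, 0) * dx
      + L (0, 0, 1, 0) * dy + L (0, 0, 0, 1) * dz)"
    by (rule ext, simp only: split_paired_all prod.case, rule L_eq)
  with L have "has_partials f (L (1, 0, 0, 0)) (L (0, 1, 0, 0)) (L (0, 0, 1, 0)) (L (0, 0, 0, 1)) a"
    unfolding has_partials_def by simp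
  with has_partials_imp_D[OF this] show ?thesis
    by simp
qed

section \<open>Closure properties of continuously differentiable fields\<close>

lemma C1_on_const: "C1_on \<Omega> (\<lambda>_. k)"
  unfolding C1_on_def
  by (rule exI[of _ "\<lambda>_. 0"]) (auto simp: zero_blinfun.rep_eq)

lemma C1_on_add:
  assumes "C1_on \<Omega> f" "C1_on \<Omega> g"
  shows "C1_on \<Omega> (\<lambda>a. f a + g a)"
proof -
  from assms obtain f' g' :: "point \<Rightarrow> point \<Rightarrow>\<^sub>L real" where
    "\<forall>a\<in>\<Omega>. (f has_derivative f' a) (at a)" "continuous_on \<Omega> f'"
    "\<forall>a\<in>\<Omega>. (g has_derivative g' a) (at a)" "continuous_on \<Omega> g'"
    unfolding C1_on_def by metis
  then show ?thesis
    unfolding C1_on_def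
    by (intro exI[of _ "\<lambda>a. f' a + g' a"])
      (auto simp: plus_blinfun.rep_eq intro!: has_derivative_add continuous_intros)
qed

lemma C1_on_cmult:
  assumes "C1_on \<Omega> f"
  shows "C1_on \<Omega> (\<lambda>a. k * f a)"
proof -
  from assms obtain f' :: "point \<Rightarrow> point \<Rightarrow>\<^sub>L real" where
    "\<forall>a\<in>\<Omega>. (f has_derivative f' a) (at a)" "continuous_on \<Omega> f'"
    unfolding C1_on_def by metis
  then show ?thesis
    unfolding C1_on_def
    by (intro exI[of _ "\<lambda>a. k *\<^sub>R f' a"])
      (auto simp: scaleR_blinfun.rep_eq intro!: has_derivative_mult_right continuous_intros)
qed

text \<open>The inner derivative \<open>L\<close> is the same at every point, as for an affine map.
  Hence the derivative of the composite is \<open>f' (\<phi> a)\<close> followed by composition with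
  a fixed operator, and its continuity reduces to that of \<open>f'\<close> and
  \<open>\<phi>\<close>.\<close>

lemma C1_on_compose:
  fixes L :: "point \<Rightarrow>\<^sub>L point"
  assumes "C1_on \<Omega> f" and \<phi>: "\<And>a. (\<phi> has_derivative L) (at a)"
  shows "C1_on (\<phi> -` \<Omega>) (\<lambda>a. f (\<phi> a))"
proof -
  from assms obtain f' :: "point \<Rightarrow> point \<Rightarrow>\<^sub>L real" where
    f': "\<forall>a\<in>\<Omega>. (f has_derivative f' a) (at a)" "continuous_on \<Omega> f'"
    unfolding C1_on_def by metis
  have "continuous_on (\<phi> -` \<Omega>) \<phi>"
    by (rule continuous_at_imp_continuous_on) (auto intro: has_derivative_continuous[OF \<phi>])
  then have "continuous_on (\<phi> -` \<Omega>) (\<lambda>a. f' (\<phi> a) o\<^sub>L L)"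
    using f'(2) by (auto intro!: continuous_intros continuous_on_compose2[OF f'(2)])
  moreover have "((\<lambda>a. f (\<phi> a)) has_derivative (f' (\<phi> a) o\<^sub>L L)) (at a)" if "\<phi> a \<in> \<Omega>" for a
    using has_derivative_compose[OF \<phi>, of f "f' (\<phi> a)"] f'(1) that
    by (simp add: blinfun_compose.rep_eq o_def)
  ultimately show ?thesis
    unfolding C1_on_def by (intro exI[of _ "\<lambda>a. f' (\<phi> a) o\<^sub>L L"]) auto
qed

section \<open>Linearity of the partial derivatives\<close>

lemma D_cmult_add_const:
  assumes "C1_on \<Omega> f" "a \<in> \<Omega>"
  shows "D_t (\<lambda>a. k * f a + m) a = k * D_t f a" "D_x (\<lambda>a. k * f a + m) a = k * D_x f a"
    "D_y (\<lambda>a. k * f a + m) a = k * D_y f a" "D_z (\<lambda>a. k * f a + m) a = k * D_z f a"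
proof -
  have "has_partials (\<lambda>a. k * f a + m) (k * D_t f a) (k * D_x f a) (k * D_y f a) (k * D_z f a) a"
    using C1_on_imp_has_partials[OF assms] unfolding has_partials_def
    by (auto intro!: derivative_eq_intros simp: algebra_simps split_beta)
  from has_partials_imp_D[OF this] show
    "D_t (\<lambda>a. k * f a + m) a = k * D_t f a" "D_x (\<lambda>a. k * f a + m) a = k * D_x f a"
    "D_y (\<lambda>a. k * f a + m) a = k * D_y f a" "D_z (\<lambda>a. k * f a + m) a = k * D_z f a" .
qed

lemma D_add:
  assumes "C1_on \<Omega> f" "C1_on \<Omega> g" "a \<in> \<Omega>"
  shows "D_t (\<lambda>a. f a + g a) a = D_t f a + D_t g a" "D_x (\<lambda>a. f a + g a) a = D_x f a + D_x g a"
    "D_y (\<lambda>a. f a + g a) a = D_y f a + D_y g a" "D_z (\<lambda>a. f a + g a) a = D_z f a + D_z g a"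
proof -
  have "has_partials (\<lambda>a. f a + g a) (D_t f a + D_t g a) (D_x f a + D_x g a)
      (D_y f a + D_y g a) (D_z f a + D_z g a) a"
    using C1_on_imp_has_partials[OF assms(1,3)] C1_on_imp_has_partials[OF assms(2,3)]
    unfolding has_partials_def
    by (auto intro!: derivative_eq_intros simp: algebra_simps split_beta)
  from has_partials_imp_D[OF this] show
    "D_t (\<lambda>a. f a + g a) a = D_t f a + D_t g a" "D_x (\<lambda>a. f a + g a) a = D_x f a + D_x g a"
    "D_y (\<lambda>a. f a + g a) a = D_y f a + D_y g a" "D_z (\<lambda>a. f a + g a) a = D_z f a + D_z g a" .
qed

section \<open>The general affine transformation of solutions\<close>

text \<open>The numbers \<open>aij\<close> are the entries of the matrix A, row by row;
  \<open>b\<close> is the drift velocity and \<open>c\<close> the shift. As A times its transpose is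
  symmetric, its six independent entries express the whole condition. They are products of rows, the
  form in which they arise in \<open>Au\<close> and \<open>div\<close> below.\<close>

locale euler_transformation =
  fixes \<tau> t0 :: real
    and a11 a12 a13 a21 a22 a23 a31 a32 a33 :: real
    and b1 b2 b3 c1 c2 c3 :: real
    and \<sigma> :: real
  assumes orth:
    "\<sigma> * (a11 * a11 + a12 * a12 + a13 * a13) = 1"
    "\<sigma> * (a21 * a21 + a22 * a22 + a23 * a23) = 1"
    "\<sigma> * (a31 * a31 + a32 * a32 + a33 * a33) = 1"
    "\<sigma> * (a11 * a21 + a12 * a22 + a13 * a23) = 0"
    "\<sigma> * (a11 * a31 + a12 * a32 + a13 * a33) = 0"
    "\<sigma> * (a21 * a31 + a22 * a32 + a23 * a33) = 0"
begin

definition \<phi> :: "point \<Rightarrow> point" where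
  "\<phi> = (\<lambda>(t, x, y, z).
     (\<tau> * t + t0,
      a11 * x + a12 * y + a13 * z + b1 * t + c1,
      a21 * x + a22 * y + a23 * z + b2 * t + c2,
      a31 * x + a32 * y + a33 * z + b3 * t + c3))"

text \<open>The linear part of the affine map \<open>\<phi>\<close>, and thus its derivative at
  every point, as \<open>C1_on_compose\<close> requires.\<close>

definition \<phi>_lin :: "point \<Rightarrow> point" where
  "\<phi>_lin = (\<lambda>(t, x, y, z).
     (\<tau> * t,
      a11 * x + a12 * y + a13 * z + b1 * t,
      a21 * x + a22 * y + a23 * z + b2 * t,
      a31 * x + a32 * y + a33 * z + b3 * t))"

lemma has_derivative_\<phi>: "(\<phi> has_derivative \<phi>_lin) (at a)"
  unfolding \<phi>_def \<phi>_lin_def split_beta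
  by (rule derivative_eq_intros refl)+ (auto simp: fun_eq_iff)

lemma continuous_\<phi>: "isCont \<phi> a"
  by (rule has_derivative_continuous[OF has_derivative_\<phi>])

lemma C1_on_\<phi>:
  assumes "C1_on \<Omega> f"
  shows "C1_on (\<phi> -` \<Omega>) (\<lambda>a. f (\<phi> a))"
proof (rule C1_on_compose[OF assms])
  show "(\<phi> has_derivative Blinfun \<phi>_lin) (at a)" for a
    using has_derivative_\<phi>[of a] has_derivative_bounded_linear[OF has_derivative_\<phi>]
    by (simp add: bounded_linear_Blinfun_apply)
qed

text \<open>Chain rule in coordinates: spatial gradients are multiplied by the transpose of A, so
  columns of A appear, and the time derivative acquires a transport term along the drift
  \<open>b\<close>.\<close>

lemma D_\<phi>:
  assumes "C1_on \<Omega> f" "\<phi> a \<in> \<Omega>"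
  shows "D_t (\<lambda>a. f (\<phi> a)) a =
      \<tau> * D_t f (\<phi> a) + b1 * D_x f (\<phi> a) + b2 * D_y f (\<phi> a) + b3 * D_z f (\<phi> a)"
    "D_x (\<lambda>a. f (\<phi> a)) a = a11 * D_x f (\<phi> a) + a21 * D_y f (\<phi> a) + a31 * D_z f (\<phi> a)"
    "D_y (\<lambda>a. f (\<phi> a)) a = a12 * D_x f (\<phi> a) + a22 * D_y f (\<phi> a) + a32 * D_z f (\<phi> a)"
    "D_z (\<lambda>a. f (\<phi> a)) a = a13 * D_x f (\<phi> a) + a23 * D_y f (\<phi> a) + a33 * D_z f (\<phi> a)"
proof -
  note f = C1_on_imp_has_partials[OF assms]
  have *: "has_partials (\<lambda>a. f (\<phi> a))
      (\<tau> * D_t f (\<phi> a) + b1 * D_x f (\<phi> a) + b2 * D_y f (\<phi> a) + b3 * D_z f (\<phi> a))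
      (a11 * D_x f (\<phi> a) + a21 * D_y f (\<phi> a) + a31 * D_z f (\<phi> a))
      (a12 * D_x f (\<phi> a) + a22 * D_y f (\<phi> a) + a32 * D_z f (\<phi> a))
      (a13 * D_x f (\<phi> a) + a23 * D_y f (\<phi> a) + a33 * D_z f (\<phi> a)) a"
    unfolding has_partials_def
    using has_derivative_compose[OF has_derivative_\<phi> f[unfolded has_partials_def]]
    by (rule has_derivative_eq_rhs) (auto simp: \<phi>_lin_def fun_eq_iff algebra_simps)
  from has_partials_imp_D[OF *] show "D_t (\<lambda>a. f (\<phi> a)) a =
      \<tau> * D_t f (\<phi> a) + b1 * D_x f (\<phi> a) + b2 * D_y f (\<phi> a) + b3 * D_z f (\<phi> a)"
    "D_x (\<lambda>a. f (\<phi> a)) a = a11 * D_x f (\<phi> a) + a21 * D_y f (\<phi> a) + a31 * D_z f (\<phi> a)"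
    "D_y (\<lambda>a. f (\<phi> a)) a = a12 * D_x f (\<phi> a) + a22 * D_y f (\<phi> a) + a32 * D_z f (\<phi> a)"
    "D_z (\<lambda>a. f (\<phi> a)) a = a13 * D_x f (\<phi> a) + a23 * D_y f (\<phi> a) + a33 * D_z f (\<phi> a)" .
qed

theorem euler_solution_transform:
  assumes sol: "euler_solution \<gamma> \<Omega> U V W P Q"
    and \<rho>: "\<rho> \<noteq> 0" and \<kappa>: "\<kappa> = \<sigma> * \<tau>\<^sup>2 * \<rho>"
  shows "euler_solution \<gamma> (\<phi> -` \<Omega>)
    (\<lambda>a. \<sigma> * (a11 * (\<tau> * U (\<phi> a) - b1) + a21 * (\<tau> * V (\<phi> a) - b2) + a31 * (\<tau> * W (\<phi> a) - b3)))
    (\<lambda>a. \<sigma> * (a12 * (\<tau> * U (\<phi> a) - b1) + a22 * (\<tau> * V (\<phi> a) - b2) + a32 * (\<tau> * W (\<phi> a) - b3)))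
    (\<lambda>a. \<sigma> * (a13 * (\<tau> * U (\<phi> a) - b1) + a23 * (\<tau> * V (\<phi> a) - b2) + a33 * (\<tau> * W (\<phi> a) - b3)))
    (\<lambda>a. \<kappa> * P (\<phi> a)) (\<lambda>a. \<rho> * Q (\<phi> a))"
proof -
  let ?S = "\<phi> -` \<Omega>"
  \<comment> \<open>The three new velocity components differ only in the column of A that supplies
    \<open>k1 k2 k3\<close>. Keeping these as parameters lets one computation serve all three
    momentum equations.\<close>
  define vel where "vel = (\<lambda>k1 k2 k3 a. \<sigma> * (k1 * (\<tau> * U (\<phi> a) - b1)
      + k2 * (\<tau> * V (\<phi> a) - b2) + k3 * (\<tau> * W (\<phi> a) - b3)))"
  define u where "u = vel a11 a21 a31"
  define v where "v = vel a12 a22 a32"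
  define w where "w = vel a13 a23 a33"
  define p where "p = (\<lambda>a. \<kappa> * P (\<phi> a))"
  define q where "q = (\<lambda>a. \<rho> * Q (\<phi> a))"
  have C1: "C1_on \<Omega> U" "C1_on \<Omega> V" "C1_on \<Omega> W" "C1_on \<Omega> P" "C1_on \<Omega> Q" and "open \<Omega>"
    using sol by (auto simp: euler_solution_def)
  \<comment> \<open>The zeros give each summand the shape required by \<open>D_cmult_add_const\<close>.\<close>
  have vel: "vel k1 k2 k3 = (\<lambda>a. (\<sigma> * \<tau> * k1) * U (\<phi> a) + 0 + ((\<sigma> * \<tau> * k2) * V (\<phi> a) + 0
      + ((\<sigma> * \<tau> * k3) * W (\<phi> a) + - \<sigma> * (k1 * b1 + k2 * b2 + k3 * b3))))" for k1 k2 k3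
    unfolding vel_def by (simp add: fun_eq_iff algebra_simps)
  have C1_vel: "C1_on ?S (vel k1 k2 k3)" for k1 k2 k3
    unfolding vel by (intro C1_on_add C1_on_cmult C1_on_const C1_on_\<phi> C1)
  have C1_pq: "C1_on ?S p" "C1_on ?S q"
    unfolding p_def q_def by (intro C1_on_cmult C1_on_\<phi> C1)+
  have "open ?S"
    using \<open>open \<Omega>\<close> continuous_\<phi> by (simp add: continuous_at_imp_continuous_on open_vimage)
  have D_vel:
    "D_t (vel k1 k2 k3) a = \<sigma> * \<tau> * (k1 * D_t (\<lambda>a. U (\<phi> a)) a + k2 * D_t (\<lambda>a. V (\<phi> a)) a + k3 * D_t (\<lambda>a. W (\<phi> a)) a)"
    "D_x (vel k1 k2 k3) a = \<sigma> * \<tau> * (k1 * D_x (\<lambda>a. U (\<phi> a)) a + k2 * D_x (\<lambda>a. V (\<phi> a)) a + k3 * D_x (\<lambda>a. W (\<phi> a)) a)"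
    "D_y (vel k1 k2 k3) a = \<sigma> * \<tau> * (k1 * D_y (\<lambda>a. U (\<phi> a)) a + k2 * D_y (\<lambda>a. V (\<phi> a)) a + k3 * D_y (\<lambda>a. W (\<phi> a)) a)"
    "D_z (vel k1 k2 k3) a = \<sigma> * \<tau> * (k1 * D_z (\<lambda>a. U (\<phi> a)) a + k2 * D_z (\<lambda>a. V (\<phi> a)) a + k3 * D_z (\<lambda>a. W (\<phi> a)) a)"
    if a: "a \<in> ?S" for k1 k2 k3 a
  proof -
    note C = C1(1-3)[THEN C1_on_\<phi>]
    have C': "C1_on ?S (\<lambda>a. k * f a + m)" if "C1_on ?S f" for k m f
      using that by (intro C1_on_add C1_on_cmult C1_on_const)
    \<comment> \<open>The sum in \<open>vel\<close> is nested to the right, so \<open>D_add\<close>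
      is instantiated once for the outer and once for the inner sum.\<close>
    note D = D_add[OF C'[OF C(1)] C1_on_add[OF C'[OF C(2)] C'[OF C(3)]] a]
      D_add[OF C'[OF C(2)] C'[OF C(3)] a]
      C[THEN D_cmult_add_const(1), OF a] C[THEN D_cmult_add_const(2), OF a]
      C[THEN D_cmult_add_const(3), OF a] C[THEN D_cmult_add_const(4), OF a]
    show "D_t (vel k1 k2 k3) a = \<sigma> * \<tau> * (k1 * D_t (\<lambda>a. U (\<phi> a)) a + k2 * D_t (\<lambda>a. V (\<phi> a)) a + k3 * D_t (\<lambda>a. W (\<phi> a)) a)"
      "D_x (vel k1 k2 k3) a = \<sigma> * \<tau> * (k1 * D_x (\<lambda>a. U (\<phi> a)) a + k2 * D_x (\<lambda>a. V (\<phi> a)) a + k3 * D_x (\<lambda>a. W (\<phi> a)) a)"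
      "D_y (vel k1 k2 k3) a = \<sigma> * \<tau> * (k1 * D_y (\<lambda>a. U (\<phi> a)) a + k2 * D_y (\<lambda>a. V (\<phi> a)) a + k3 * D_y (\<lambda>a. W (\<phi> a)) a)"
      "D_z (vel k1 k2 k3) a = \<sigma> * \<tau> * (k1 * D_z (\<lambda>a. U (\<phi> a)) a + k2 * D_z (\<lambda>a. V (\<phi> a)) a + k3 * D_z (\<lambda>a. W (\<phi> a)) a)"
      unfolding vel D by (simp_all only: distrib_left mult.assoc add.assoc)
  qed
  have D_pq:
    "D_t p a = \<kappa> * D_t (\<lambda>a. P (\<phi> a)) a" "D_t q a = \<rho> * D_t (\<lambda>a. Q (\<phi> a)) a"
    "D_x p a = \<kappa> * D_x (\<lambda>a. P (\<phi> a)) a" "D_x q a = \<rho> * D_x (\<lambda>a. Q (\<phi> a)) a"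
    "D_y p a = \<kappa> * D_y (\<lambda>a. P (\<phi> a)) a" "D_y q a = \<rho> * D_y (\<lambda>a. Q (\<phi> a)) a"
    "D_z p a = \<kappa> * D_z (\<lambda>a. P (\<phi> a)) a" "D_z q a = \<rho> * D_z (\<lambda>a. Q (\<phi> a)) a"
    if a: "a \<in> ?S" for a
    using D_cmult_add_const[OF C1_on_\<phi>[OF C1(4)] a, where m = 0]
      D_cmult_add_const[OF C1_on_\<phi>[OF C1(5)] a, where m = 0]
    by (simp_all add: p_def q_def)
  have Au: "a11 * u a + a12 * v a + a13 * w a = \<tau> * U (\<phi> a) - b1"
    "a21 * u a + a22 * v a + a23 * w a = \<tau> * V (\<phi> a) - b2"
    "a31 * u a + a32 * v a + a33 * w a = \<tau> * W (\<phi> a) - b3" for a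
    unfolding u_def v_def w_def vel_def using orth by algebra+
  \<comment> \<open>The transport term along \<open>b\<close> from the time derivative cancels
    against the \<open>- b\<close> in \<open>Au\<close>, leaving \<open>\<tau>\<close> times the
    velocity of the old solution.\<close>
  have mat: "D_t (\<lambda>a. f (\<phi> a)) a + u a * D_x (\<lambda>a. f (\<phi> a)) a + v a * D_y (\<lambda>a. f (\<phi> a)) a
        + w a * D_z (\<lambda>a. f (\<phi> a)) a
      = \<tau> * (D_t f (\<phi> a) + U (\<phi> a) * D_x f (\<phi> a) + V (\<phi> a) * D_y f (\<phi> a) + W (\<phi> a) * D_z f (\<phi> a))"
    if "C1_on \<Omega> f" "a \<in> ?S" for f a
    unfolding D_\<phi>[OF that(1) that(2)[unfolded vimage_def mem_Collect_eq]] using Au[of a] by algebra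
  \<comment> \<open>By \<open>D_\<phi>\<close>, the combination of derivatives of \<open>P\<close>
    with a column of A as coefficients is the matching spatial derivative of \<open>P\<close>
    composed with \<open>\<phi>\<close>. Each column therefore turns this identity into one momentum
    equation.\<close>
  have mat_vel: "D_t (vel k1 k2 k3) a + u a * D_x (vel k1 k2 k3) a + v a * D_y (vel k1 k2 k3) a
        + w a * D_z (vel k1 k2 k3) a
        + 1 / q a * (\<kappa> * (k1 * D_x P (\<phi> a) + k2 * D_y P (\<phi> a) + k3 * D_z P (\<phi> a))) = 0"
    if a: "a \<in> ?S" for k1 k2 k3 a
  proof -
    \<comment> \<open>The momentum equations are solved for the material derivatives so that they
      can be substituted into the right-hand side of \<open>mat\<close>.\<close>
    have Q: "Q (\<phi> a) \<noteq> 0" and eqs: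
      "D_t U (\<phi> a) + U (\<phi> a) * D_x U (\<phi> a) + V (\<phi> a) * D_y U (\<phi> a) + W (\<phi> a) * D_z U (\<phi> a)
        = - (1 / Q (\<phi> a) * D_x P (\<phi> a))"
      "D_t V (\<phi> a) + U (\<phi> a) * D_x V (\<phi> a) + V (\<phi> a) * D_y V (\<phi> a) + W (\<phi> a) * D_z V (\<phi> a)
        = - (1 / Q (\<phi> a) * D_y P (\<phi> a))"
      "D_t W (\<phi> a) + U (\<phi> a) * D_x W (\<phi> a) + V (\<phi> a) * D_y W (\<phi> a) + W (\<phi> a) * D_z W (\<phi> a)
        = - (1 / Q (\<phi> a) * D_z P (\<phi> a))"
      using sol a unfolding euler_solution_def by (auto simp: eq_neg_iff_add_eq_0)
    note m = C1(1-3)[THEN mat, OF a, unfolded eqs]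
    \<comment> \<open>Here the relation between \<open>\<kappa>\<close> and \<open>\<rho>\<close>
      enters: their quotient must supply one factor \<open>\<sigma> * \<tau>\<close> from
      \<open>vel\<close> and a further \<open>\<tau>\<close> from \<open>mat\<close>.\<close>
    have "1 / q a * \<kappa> = \<sigma> * \<tau> * \<tau> * (1 / Q (\<phi> a))"
      unfolding q_def \<kappa> using Q \<rho> by (simp add: field_simps power2_eq_square)
    then show ?thesis
      unfolding D_vel[OF a] using m by algebra
  qed
  have div: "D_x u a + D_y v a + D_z w a = \<tau> * (D_x U (\<phi> a) + D_y V (\<phi> a) + D_z W (\<phi> a))"
    if a: "a \<in> ?S" for a
  proof -
    note D = C1(1-3)[THEN D_\<phi>(2)] C1(1-3)[THEN D_\<phi>(3)] C1(1-3)[THEN D_\<phi>(4)]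
    note D' = D[OF a[unfolded vimage_def mem_Collect_eq]]
    \<comment> \<open>After expansion, the derivative of the i-th old component in the k-th
      direction is multiplied by \<open>\<sigma> * \<tau>\<close> times the product of rows i and k
      of A; \<open>orth\<close> keeps only the diagonal.\<close>
    show ?thesis
      unfolding u_def v_def w_def D_vel[OF a] D' using orth by algebra
  qed
  have "euler_solution \<gamma> ?S u v w p q"
    unfolding euler_solution_def
  proof (intro conjI ballI)
    show "open ?S" "C1_on ?S u" "C1_on ?S v" "C1_on ?S w" "C1_on ?S p" "C1_on ?S q"
      using \<open>open ?S\<close> C1_vel C1_pq by (auto simp: u_def v_def w_def)
  next
    fix a assume a: "a \<in> ?S"
    then have a': "\<phi> a \<in> \<Omega>" by simp
    show "q a \<noteq> 0"
      using sol a' \<rho> by (auto simp: q_def euler_solution_def)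
    note DP = D_pq[OF a] D_\<phi>(2-4)[OF C1(4) a']
    show "D_t u a + u a * D_x u a + v a * D_y u a + w a * D_z u a + 1 / q a * D_x p a = 0"
      using mat_vel[OF a, of a11 a21 a31] unfolding u_def[symmetric] DP .
    show "D_t v a + u a * D_x v a + v a * D_y v a + w a * D_z v a + 1 / q a * D_y p a = 0"
      using mat_vel[OF a, of a12 a22 a32] unfolding v_def[symmetric] DP .
    show "D_t w a + u a * D_x w a + v a * D_y w a + w a * D_z w a + 1 / q a * D_z p a = 0"
      using mat_vel[OF a, of a13 a23 a33] unfolding w_def[symmetric] DP .
    have Q: "D_t Q (\<phi> a) + Q (\<phi> a) * (D_x U (\<phi> a) + D_y V (\<phi> a) + D_z W (\<phi> a))
        + U (\<phi> a) * D_x Q (\<phi> a) + V (\<phi> a) * D_y Q (\<phi> a) + W (\<phi> a) * D_z Q (\<phi> a) = 0"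
      and P: "D_t P (\<phi> a) + \<gamma> * P (\<phi> a) * (D_x U (\<phi> a) + D_y V (\<phi> a) + D_z W (\<phi> a))
        + U (\<phi> a) * D_x P (\<phi> a) + V (\<phi> a) * D_y P (\<phi> a) + W (\<phi> a) * D_z P (\<phi> a) = 0"
      using sol a' unfolding euler_solution_def by blast+
    \<comment> \<open>The last two equations are homogeneous in the density and in the pressure
      respectively, so the new ones are \<open>\<rho> * \<tau>\<close> and
      \<open>\<kappa> * \<tau>\<close> times the old ones.\<close>
    show "D_t q a + q a * (D_x u a + D_y v a + D_z w a)
        + u a * D_x q a + v a * D_y q a + w a * D_z q a = 0"
      unfolding div[OF a] D_pq[OF a] unfolding q_def using mat[OF C1(5) a] Q by algebra
    show "D_t p a + \<gamma> * p a * (D_x u a + D_y v a + D_z w a)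
        + u a * D_x p a + v a * D_y p a + w a * D_z p a = 0"
      unfolding div[OF a] D_pq[OF a] unfolding p_def using mat[OF C1(4) a] P by algebra
  qed
  then show ?thesis
    unfolding u_def v_def w_def vel_def p_def q_def .
qed

end

section \<open>The thirteen symmetries as choices of parameters\<close>

theorem theorem3:
  fixes \<gamma> s l :: real
    and \<Omega> :: "point set"
    and U V W P Q :: "point \<Rightarrow> real"
  assumes "l \<noteq> 0"
    and "euler_solution \<gamma> \<Omega> U V W P Q"
  shows
    "euler_solution \<gamma> {(t, x, y, z). (t, x + s, y, z) \<in> \<Omega>}
       (\<lambda>(t, x, y, z). U (t, x + s, y, z))
       (\<lambda>(t, x, y, z). V (t, x + s, y, z))
       (\<lambda>(t, x, y, z). W (t, x + s, y, z))
       (\<lambda>(t, x, y, z). P (t, x + s, y, z))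
       (\<lambda>(t, x, y, z). Q (t, x + s, y, z)) \<and>
     euler_solution \<gamma> {(t, x, y, z). (t, x, y + s, z) \<in> \<Omega>}
       (\<lambda>(t, x, y, z). U (t, x, y + s, z))
       (\<lambda>(t, x, y, z). V (t, x, y + s, z))
       (\<lambda>(t, x, y, z). W (t, x, y + s, z))
       (\<lambda>(t, x, y, z). P (t, x, y + s, z))
       (\<lambda>(t, x, y, z). Q (t, x, y + s, z)) \<and>
     euler_solution \<gamma> {(t, x, y, z). (t, x, y, z + s) \<in> \<Omega>}
       (\<lambda>(t, x, y, z). U (t, x, y, z + s))
       (\<lambda>(t, x, y, z). V (t, x, y, z + s))
       (\<lambda>(t, x, y, z). W (t, x, y, z + s))
       (\<lambda>(t, x, y, z). P (t, x, y, z + s))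
       (\<lambda>(t, x, y, z). Q (t, x, y, z + s)) \<and>
     euler_solution \<gamma> {(t, x, y, z). (t + s, x, y, z) \<in> \<Omega>}
       (\<lambda>(t, x, y, z). U (t + s, x, y, z))
       (\<lambda>(t, x, y, z). V (t + s, x, y, z))
       (\<lambda>(t, x, y, z). W (t + s, x, y, z))
       (\<lambda>(t, x, y, z). P (t + s, x, y, z))
       (\<lambda>(t, x, y, z). Q (t + s, x, y, z)) \<and>
     euler_solution \<gamma> {(t, x, y, z). (t, x + s * t, y, z) \<in> \<Omega>}
       (\<lambda>(t, x, y, z). U (t, x + s * t, y, z) - s)
       (\<lambda>(t, x, y, z). V (t, x + s * t, y, z))
       (\<lambda>(t, x, y, z). W (t, x + s * t, y, z))
       (\<lambda>(t, x, y, z). P (t, x + s * t, y, z))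
       (\<lambda>(t, x, y, z). Q (t, x + s * t, y, z)) \<and>
     euler_solution \<gamma> {(t, x, y, z). (t, x, y + s * t, z) \<in> \<Omega>}
       (\<lambda>(t, x, y, z). U (t, x, y + s * t, z))
       (\<lambda>(t, x, y, z). V (t, x, y + s * t, z) - s)
       (\<lambda>(t, x, y, z). W (t, x, y + s * t, z))
       (\<lambda>(t, x, y, z). P (t, x, y + s * t, z))
       (\<lambda>(t, x, y, z). Q (t, x, y + s * t, z)) \<and>
     euler_solution \<gamma> {(t, x, y, z). (t, x, y, z + s * t) \<in> \<Omega>}
       (\<lambda>(t, x, y, z). U (t, x, y, z + s * t))
       (\<lambda>(t, x, y, z). V (t, x, y, z + s * t))
       (\<lambda>(t, x, y, z). W (t, x, y, z + s * t) - s)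
       (\<lambda>(t, x, y, z). P (t, x, y, z + s * t))
       (\<lambda>(t, x, y, z). Q (t, x, y, z + s * t)) \<and>
     euler_solution \<gamma> {(t, x, y, z). (l * t, x, y, z) \<in> \<Omega>}
       (\<lambda>(t, x, y, z). l * U (l * t, x, y, z))
       (\<lambda>(t, x, y, z). l * V (l * t, x, y, z))
       (\<lambda>(t, x, y, z). l * W (l * t, x, y, z))
       (\<lambda>(t, x, y, z). P (l * t, x, y, z))
       (\<lambda>(t, x, y, z). Q (l * t, x, y, z) / l\<^sup>2) \<and>
     euler_solution \<gamma> {(t, x, y, z). (t, l * x, l * y, l * z) \<in> \<Omega>}
       (\<lambda>(t, x, y, z). U (t, l * x, l * y, l * z) / l)
       (\<lambda>(t, x, y, z). V (t, l * x, l * y, l * z) / l)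
       (\<lambda>(t, x, y, z). W (t, l * x, l * y, l * z) / l)
       (\<lambda>(t, x, y, z). P (t, l * x, l * y, l * z))
       (\<lambda>(t, x, y, z). l\<^sup>2 * Q (t, l * x, l * y, l * z)) \<and>
     euler_solution \<gamma> {(t, x, y, z). (t, x * cos s + y * sin s, y * cos s - x * sin s, z) \<in> \<Omega>}
       (\<lambda>(t, x, y, z). cos s * U (t, x * cos s + y * sin s, y * cos s - x * sin s, z) - sin s * V (t, x * cos s + y * sin s, y * cos s - x * sin s, z))
       (\<lambda>(t, x, y, z). sin s * U (t, x * cos s + y * sin s, y * cos s - x * sin s, z) + cos s * V (t, x * cos s + y * sin s, y * cos s - x * sin s, z))
       (\<lambda>(t, x, y, z). W (t, x * cos s + y * sin s, y * cos s - x * sin s, z))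
       (\<lambda>(t, x, y, z). P (t, x * cos s + y * sin s, y * cos s - x * sin s, z))
       (\<lambda>(t, x, y, z). Q (t, x * cos s + y * sin s, y * cos s - x * sin s, z)) \<and>
     euler_solution \<gamma> {(t, x, y, z). (t, x, y * cos s - z * sin s, z * cos s + y * sin s) \<in> \<Omega>}
       (\<lambda>(t, x, y, z). U (t, x, y * cos s - z * sin s, z * cos s + y * sin s))
       (\<lambda>(t, x, y, z). cos s * V (t, x, y * cos s - z * sin s, z * cos s + y * sin s) + sin s * W (t, x, y * cos s - z * sin s, z * cos s + y * sin s))
       (\<lambda>(t, x, y, z). cos s * W (t, x, y * cos s - z * sin s, z * cos s + y * sin s) - sin s * V (t, x, y * cos s - z * sin s, z * cos s + y * sin s))
       (\<lambda>(t, x, y, z). P (t, x, y * cos s - z * sin s, z * cos s + y * sin s))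
       (\<lambda>(t, x, y, z). Q (t, x, y * cos s - z * sin s, z * cos s + y * sin s)) \<and>
     euler_solution \<gamma> {(t, x, y, z). (t, x * cos s - z * sin s, y, x * sin s + z * cos s) \<in> \<Omega>}
       (\<lambda>(t, x, y, z). cos s * U (t, x * cos s - z * sin s, y, x * sin s + z * cos s) + sin s * W (t, x * cos s - z * sin s, y, x * sin s + z * cos s))
       (\<lambda>(t, x, y, z). V (t, x * cos s - z * sin s, y, x * sin s + z * cos s))
       (\<lambda>(t, x, y, z). cos s * W (t, x * cos s - z * sin s, y, x * sin s + z * cos s) - sin s * U (t, x * cos s - z * sin s, y, x * sin s + z * cos s))
       (\<lambda>(t, x, y, z). P (t, x * cos s - z * sin s, y, x * sin s + z * cos s))
       (\<lambda>(t, x, y, z). Q (t, x * cos s - z * sin s, y, x * sin s + z * cos s)) \<and>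
     euler_solution \<gamma> {(t, x, y, z). (t, x, y, z) \<in> \<Omega>}
       (\<lambda>(t, x, y, z). U (t, x, y, z))
       (\<lambda>(t, x, y, z). V (t, x, y, z))
       (\<lambda>(t, x, y, z). W (t, x, y, z))
       (\<lambda>(t, x, y, z). l * P (t, x, y, z))
       (\<lambda>(t, x, y, z). l * Q (t, x, y, z))"
proof (intro conjI, goal_cases)
  case 1
  \<comment> \<open>The arguments are \<open>\<tau>\<close>, \<open>t0\<close>, the rows of A,
    \<open>b\<close>, \<open>c\<close> and \<open>\<sigma>\<close>. A space translation is a shift
    \<open>c\<close>.\<close>
  interpret euler_transformation 1 0 1 0 0 0 1 0 0 0 1 0 0 0 s 0 0 1
    using assms(1) by unfold_locales (simp_all flip: power2_eq_square)
  show ?case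
    \<comment> \<open>The two instances are \<open>\<rho>\<close> and \<open>\<kappa>\<close>, in
      this order; for \<open>\<sigma> = \<tau> = 1\<close> they must agree.\<close>
    using euler_solution_transform[OF assms(2), of 1 1] assms(1)
    by (simp add: \<phi>_def vimage_def case_prod_unfold algebra_simps power2_eq_square)
next
  case 2
  interpret euler_transformation 1 0 1 0 0 0 1 0 0 0 1 0 0 0 0 s 0 1
    using assms(1) by unfold_locales (simp_all flip: power2_eq_square)
  show ?case
    using euler_solution_transform[OF assms(2), of 1 1] assms(1)
    by (simp add: \<phi>_def vimage_def case_prod_unfold algebra_simps power2_eq_square)
next
  case 3
  interpret euler_transformation 1 0 1 0 0 0 1 0 0 0 1 0 0 0 0 0 s 1
    using assms(1) by unfold_locales (simp_all flip: power2_eq_square)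
  show ?case
    using euler_solution_transform[OF assms(2), of 1 1] assms(1)
    by (simp add: \<phi>_def vimage_def case_prod_unfold algebra_simps power2_eq_square)
next
  case 4
  \<comment> \<open>Time translation: \<open>t0 = s\<close>.\<close>
  interpret euler_transformation 1 s 1 0 0 0 1 0 0 0 1 0 0 0 0 0 0 1
    using assms(1) by unfold_locales (simp_all flip: power2_eq_square)
  show ?case
    using euler_solution_transform[OF assms(2), of 1 1] assms(1)
    by (simp add: \<phi>_def vimage_def case_prod_unfold algebra_simps power2_eq_square)
next
  case 5
  \<comment> \<open>Galilean boost: the drift \<open>b\<close> moves the frame and is subtracted
    from the velocity.\<close>
  interpret euler_transformation 1 0 1 0 0 0 1 0 0 0 1 s 0 0 0 0 0 1
    using assms(1) by unfold_locales (simp_all flip: power2_eq_square)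
  show ?case
    using euler_solution_transform[OF assms(2), of 1 1] assms(1)
    by (simp add: \<phi>_def vimage_def case_prod_unfold algebra_simps power2_eq_square)
next
  case 6
  interpret euler_transformation 1 0 1 0 0 0 1 0 0 0 1 0 s 0 0 0 0 1
    using assms(1) by unfold_locales (simp_all flip: power2_eq_square)
  show ?case
    using euler_solution_transform[OF assms(2), of 1 1] assms(1)
    by (simp add: \<phi>_def vimage_def case_prod_unfold algebra_simps power2_eq_square)
next
  case 7
  interpret euler_transformation 1 0 1 0 0 0 1 0 0 0 1 0 0 s 0 0 0 1
    using assms(1) by unfold_locales (simp_all flip: power2_eq_square)
  show ?case
    using euler_solution_transform[OF assms(2), of 1 1] assms(1)
    by (simp add: \<phi>_def vimage_def case_prod_unfold algebra_simps power2_eq_square)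
next
  case 8
  \<comment> \<open>Time scaling \<open>\<tau> = l\<close>: an unchanged pressure forces
    \<open>\<rho> = 1 / l\<^sup>2\<close>.\<close>
  interpret euler_transformation l 0 1 0 0 0 1 0 0 0 1 0 0 0 0 0 0 1
    using assms(1) by unfold_locales (simp_all flip: power2_eq_square)
  show ?case
    using euler_solution_transform[OF assms(2), of "1 / l\<^sup>2" 1] assms(1)
    by (simp add: \<phi>_def vimage_def case_prod_unfold algebra_simps power2_eq_square)
next
  case 9
  \<comment> \<open>Space scaling: A is \<open>l\<close> times the identity, so
    \<open>\<sigma> = 1 / l\<^sup>2\<close>. The velocity factor is
    \<open>\<sigma> * l = 1 / l\<close>, and an unchanged pressure forces
    \<open>\<rho> = l\<^sup>2\<close>.\<close>
  interpret euler_transformation 1 0 l 0 0 0 l 0 0 0 l 0 0 0 0 0 0 "1 / l\<^sup>2"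
    using assms(1) by unfold_locales (simp_all flip: power2_eq_square)
  show ?case
    using euler_solution_transform[OF assms(2), of "l\<^sup>2" 1] assms(1)
    by (simp add: \<phi>_def vimage_def case_prod_unfold algebra_simps power2_eq_square)
next
  case 10
  \<comment> \<open>A rotation about the z axis; the velocity is turned by its transpose. Folding
    products into squares exposes the Pythagorean identity behind \<open>orth\<close>.\<close>
  interpret euler_transformation 1 0 "cos s" "sin s" 0 "- sin s" "cos s" 0 0 0 1 0 0 0 0 0 0 1
    using assms(1) by unfold_locales (simp_all flip: power2_eq_square)
  show ?case
    using euler_solution_transform[OF assms(2), of 1 1] assms(1)
    by (simp add: \<phi>_def vimage_def case_prod_unfold algebra_simps power2_eq_square)
next
  case 11
  interpret euler_transformation 1 0 1 0 0 0 "cos s" "- sin s" 0 "sin s" "cos s" 0 0 0 0 0 0 1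
    using assms(1) by unfold_locales (simp_all flip: power2_eq_square)
  show ?case
    using euler_solution_transform[OF assms(2), of 1 1] assms(1)
    by (simp add: \<phi>_def vimage_def case_prod_unfold algebra_simps power2_eq_square)
next
  case 12
  interpret euler_transformation 1 0 "cos s" 0 "- sin s" 0 1 0 "sin s" 0 "cos s" 0 0 0 0 0 0 1
    using assms(1) by unfold_locales (simp_all flip: power2_eq_square)
  show ?case
    using euler_solution_transform[OF assms(2), of 1 1] assms(1)
    by (simp add: \<phi>_def vimage_def case_prod_unfold algebra_simps power2_eq_square)
next
  case 13
  \<comment> \<open>Here \<open>\<phi>\<close> is the identity, and
    \<open>\<rho> = \<kappa> = l\<close> is the common factor of pressure and density.\<close>
  interpret euler_transformation 1 0 1 0 0 0 1 0 0 0 1 0 0 0 0 0 0 1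
    using assms(1) by unfold_locales (simp_all flip: power2_eq_square)
  show ?case
    using euler_solution_transform[OF assms(2), of l l] assms(1)
    by (simp add: \<phi>_def vimage_def case_prod_unfold algebra_simps power2_eq_square)
qed

end
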